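(* For $\lambda\in\mathbb{C}$ let $f_\lambda(z)=\lambda+\tan(z^2)$. There are four unbounded regions $A_1,A_2,A_3,A_4\subset\mathbb{C}$, one in each of the four quadrants of the complex plane, such that for every $i\in\{1,2,3,4\}$ and every $\lambda\in A_i$, all singular values of $f_\lambda$ are attracted by an attracting fixed point of $f_\lambda$.
   Context: A region is a nonempty connected open set. The singular values of $f_\lambda$ are its two asymptotic values $\lambda+i$ and $\lambda-i$ and its critical value $\lambda=f_\lambda(0)$ (the only critical point is the origin). A fixed point $p$ of $f_\lambda$ is attracting if $|f_\lambda'(p)|<1$; a point $z$ is attracted by $p$ if $f_\lambda^{\circ n}(z)\to p$ as $n\to\infty$. *)

theory Defs
  imports "HOL-Complex_Analysis.Complex_Analysis"
begin

definition tan_sq :: "complex \<Rightarrow> complex \<Rightarrow> complex" where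
  "tan_sq l z = l + tan (z\<^sup>2)"

definition region :: "complex set \<Rightarrow> bool" where
  "region A \<longleftrightarrow> A \<noteq> {} \<and> connected A \<and> open A"

text \<open>
  Transcendental meromorphic functions on the plane are represented by total functions on
  \<^typ>\<open>complex\<close>. The value at a pole is then an artefact of totality (for instance
  \<^term>\<open>tan (z::complex)\<close> is \<^term>\<open>0::complex\<close> at the zeros of \<^term>\<open>cos (z::complex)\<close>),
  so all notions below exclude the poles explicitly.
\<close>

definition critical_point :: "(complex \<Rightarrow> complex) \<Rightarrow> complex \<Rightarrow> bool" where
  "critical_point f c \<longleftrightarrow> \<not> is_pole f c \<and> deriv f c = 0"

text \<open>Finite asymptotic values: limits of \<open>f\<close> along curves in its domain that tend to \<open>\<infinity>\<close>.\<close>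

definition asymptotic_value :: "(complex \<Rightarrow> complex) \<Rightarrow> complex \<Rightarrow> bool" where
  "asymptotic_value f a \<longleftrightarrow>
     (\<exists>\<gamma> :: real \<Rightarrow> complex.
        continuous_on {0..} \<gamma> \<and> (\<forall>t\<ge>0. \<not> is_pole f (\<gamma> t)) \<and>
        filterlim \<gamma> at_infinity at_top \<and> ((\<lambda>t. f (\<gamma> t)) \<longlongrightarrow> a) at_top)"

definition singular_values :: "(complex \<Rightarrow> complex) \<Rightarrow> complex set" where
  "singular_values f = {f c |c. critical_point f c} \<union> {a. asymptotic_value f a}"

definition attracting_fixed_point :: "(complex \<Rightarrow> complex) \<Rightarrow> complex \<Rightarrow> bool" where
  "attracting_fixed_point f p \<longleftrightarrow> \<not> is_pole f p \<and> f p = p \<and> norm (deriv f p) < 1"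

text \<open>The orbit must never hit a pole, since the iterates of \<open>f\<close> are undefined from there on.\<close>

definition attracted_by :: "(complex \<Rightarrow> complex) \<Rightarrow> complex \<Rightarrow> complex \<Rightarrow> bool" where
  "attracted_by f z p \<longleftrightarrow>
     (\<forall>n. \<not> is_pole f ((f ^^ n) z)) \<and> (\<lambda>n. (f ^^ n) z) \<longlonglongrightarrow> p"

end

theory Submission
  imports Defs
begin

text \<open>
  Away from the coordinate axes \<open>tan (z\<^sup>2)\<close> is tame: the bound \<open>\<bar>Im w\<bar> \<le> \<bar>cos w\<bar>\<close> makes
  \<open>\<bar>tan w\<bar>\<close> at most 2 and the derivative \<open>2 z / cos (z\<^sup>2)\<^sup>2\<close> at most \<open>1/2\<close> in modulus as soon as
  \<open>\<bar>Re z\<bar>\<close> and \<open>\<bar>Im z\<bar>\<close> are at least 2. If both coordinates of \<open>\<lambda>\<close> exceed 4 in modulus, this covers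
  the closed disc of radius 2 about \<open>\<lambda>\<close>, so that disc is mapped into itself by a contraction with
  factor \<open>1/2\<close> (\<open>tan_sq_maps_cball\<close>, \<open>tan_sq_contracts_cball\<close>). By Banach's fixed point theorem
  it contains a fixed point that attracts the whole disc. The disc also contains \<open>\<lambda>\<close>,
  \<open>\<lambda> + \<i>\<close> and \<open>\<lambda> - \<i>\<close>, so the four open quadrants \<open>\<bar>Re \<lambda>\<bar> > 4\<close>, \<open>\<bar>Im \<lambda>\<bar> > 4\<close> serve as the four
  regions.

  It remains to see that there are no other singular values. The critical points are immediate once
  the poles are known to be exactly the zeros of \<open>cos (z\<^sup>2)\<close>. For the asymptotic values,
  \<open>exp (2 \<i> w)\<close> is a Moebius image of \<open>tan w\<close> that takes \<open>\<i>\<close> and \<open>-\<i>\<close> to \<open>0\<close> and \<open>\<infinity>\<close>.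
  Along a curve to infinity on which \<open>tan w\<close> tends to any other value, \<open>exp (2 \<i> w)\<close> would
  tend to a nonzero finite limit; but \<open>exp\<close> is a covering of the punctured plane, which forces the
  curve itself to converge (\<open>exp_path_lift_converges\<close>).
\<close>

section \<open>Poles and derivative\<close>

lemma has_field_derivative_tan_sq:
  assumes "cos (z\<^sup>2) \<noteq> 0"
  shows "(tan_sq l has_field_derivative (2 * z / (cos (z\<^sup>2))\<^sup>2)) (at z within S)"
proof -
  have "((\<lambda>z. l + tan (z\<^sup>2)) has_field_derivative (2 * z / (cos (z\<^sup>2))\<^sup>2)) (at z)"
    using assms by (auto intro!: derivative_eq_intros simp: divide_simps)
  then show ?thesis
    unfolding tan_sq_def by (rule has_field_derivative_at_within)
qed

lemma is_pole_tan_sq_iff: "is_pole (tan_sq l) z \<longleftrightarrow> cos (z\<^sup>2) = 0"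
proof
  assume pole: "is_pole (tan_sq l) z"
  show "cos (z\<^sup>2) = 0"
  proof (rule ccontr)
    assume "cos (z\<^sup>2) \<noteq> 0"
    then have "isCont (tan_sq l) z"
      using has_field_derivative_tan_sq DERIV_isCont by blast
    then show False
      using pole not_tendsto_and_filterlim_at_infinity[of "at z"]
      unfolding isCont_def is_pole_def by auto
  qed
next
  assume 0: "cos (z\<^sup>2) = 0"
  have "\<forall>\<^sub>F w in at z. cos (w\<^sup>2) \<noteq> 0 \<and> w \<in> UNIV"
    by (rule non_zero_neighbour_alt[where \<beta> = 0]) (auto intro!: holomorphic_intros)
  moreover have "((\<lambda>w. cos (w\<^sup>2)) \<longlongrightarrow> cos (z\<^sup>2)) (at z)"
    by (intro tendsto_intros)
  ultimately have "filterlim (\<lambda>w. cos (w\<^sup>2)) (at 0) (at z)"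
    using 0 by (auto simp: filterlim_at)
  moreover have "sin (z\<^sup>2) \<noteq> 0"
    using 0 sin_cos_squared_add[of "z\<^sup>2"] by auto
  ultimately have "is_pole (\<lambda>w. sin (w\<^sup>2) / cos (w\<^sup>2)) z"
    by (intro is_pole_divide) auto
  then have "is_pole (\<lambda>w. sin (w\<^sup>2) / cos (w\<^sup>2) + l) z"
    by (rule is_pole_plus_const_iff[THEN iffD1])
  then show "is_pole (tan_sq l) z"
    by (simp add: tan_sq_def[abs_def] tan_def add.commute)
qed

section \<open>Singular values\<close>

lemma critical_point_tan_sq: "critical_point (tan_sq l) c \<Longrightarrow> c = 0"
  using DERIV_imp_deriv[OF has_field_derivative_tan_sq, of c l]
  by (auto simp: critical_point_def is_pole_tan_sq_iff)

text \<open>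
  On the disc of radius 1 about 1 the principal logarithm is a continuous inverse of \<open>exp\<close>. Once
  \<open>exp (W t)\<close>, divided by its limit, has entered that disc, the difference of \<open>W\<close> and this logarithm
  is continuous with values in the discrete set \<open>2 \<pi> \<i> \<int>\<close>, hence constant.
\<close>

lemma exp_path_lift_converges:
  fixes W :: "real \<Rightarrow> complex"
  assumes cont: "continuous_on {a..} W"
    and lim: "((\<lambda>t. exp (W t)) \<longlongrightarrow> b) at_top" and "b \<noteq> 0"
  shows "\<exists>c. (W \<longlongrightarrow> c) at_top"
proof -
  define V where "V t = exp (W t) / b" for t
  have V1: "(V \<longlongrightarrow> 1) at_top"
    unfolding V_def using tendsto_divide[OF lim tendsto_const \<open>b \<noteq> 0\<close>] \<open>b \<noteq> 0\<close> by simp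
  then have "\<forall>\<^sub>F t in at_top. dist (V t) 1 < 1 \<and> t \<ge> a"
    by (intro eventually_conj tendstoD eventually_ge_at_top) auto
  then obtain T where T: "\<And>t. t \<ge> T \<Longrightarrow> dist (V t) 1 < 1 \<and> t \<ge> a"
    by (auto simp: eventually_at_top_linorder)
  have slit: "V t \<notin> \<real>\<^sub>\<le>\<^sub>0" and nz: "V t \<noteq> 0" if "t \<ge> T" for t
  proof -
    have "\<bar>Re (V t - 1)\<bar> < 1"
      using T[OF that] abs_Re_le_cmod[of "V t - 1"] unfolding dist_norm by linarith
    then have "Re (V t) > 0"
      by simp
    then show "V t \<notin> \<real>\<^sub>\<le>\<^sub>0" "V t \<noteq> 0"
      by (auto simp: complex_nonpos_Reals_iff)
  qed
  define D where "D t = W t - Ln (V t)" for t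
  have contW: "continuous_on {T..} W"
    using cont by (rule continuous_on_subset) (use T in auto)
  have contV: "continuous_on {T..} V"
    unfolding V_def using contW \<open>b \<noteq> 0\<close> by (intro continuous_intros) auto
  have contD: "continuous_on {T..} D"
    unfolding D_def using contW contV slit by (intro continuous_intros) auto
  have expD: "exp (D t) = b" if "t \<ge> T" for t
    using nz[OF that] \<open>b \<noteq> 0\<close> by (auto simp: D_def exp_diff V_def)
  have sep: "2 * pi \<le> norm (D s - D t)" if "s \<ge> T" "t \<ge> T" "D s \<noteq> D t" for s t
  proof -
    have "exp (D s) = exp (D t)"
      using expD that by simp
    then obtain n :: int where n: "D s = D t + (of_int (2 * n) * pi) * \<i>"
      unfolding exp_eq by blast
    then have "n \<noteq> 0" using that by auto
    then have "1 \<le> \<bar>real_of_int n\<bar>" by linarith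
    then show ?thesis
      unfolding n by (simp add: norm_mult)
  qed
  have "D constant_on {T..}"
  proof (rule continuous_discrete_range_constant[OF _ contD])
    show "\<exists>e>0. \<forall>y. y \<in> {T..} \<and> D y \<noteq> D x \<longrightarrow> e \<le> norm (D y - D x)" if "x \<in> {T..}" for x
      using sep that by (intro exI[of _ "2 * pi"]) auto
  qed auto
  then obtain d where d: "\<And>t. t \<ge> T \<Longrightarrow> D t = d"
    by (auto simp: constant_on_def)
  have "((\<lambda>t. d + Ln (V t)) \<longlongrightarrow> d + Ln 1) at_top"
    by (intro tendsto_intros V1) auto
  then have "(W \<longlongrightarrow> d + Ln 1) at_top"
    by (rule Lim_transform_eventually)
      (use d in \<open>auto simp: D_def eventually_at_top_linorder diff_eq_eq intro!: exI[of _ T]\<close>)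
  then show ?thesis by blast
qed

lemma exp_eq_tan:
  fixes w :: complex
  assumes "cos w \<noteq> 0"
  shows "exp (2 * \<i> * w) * (1 - \<i> * tan w) = 1 + \<i> * tan w"
proof -
  have "exp (- (\<i> * w)) = cos w - \<i> * sin w"
    using exp_Euler[of "- w"] by simp
  then have "exp (\<i> * w) * (cos w - \<i> * sin w) = 1"
    using exp_minus_inverse[of "\<i> * w"] by simp
  moreover have "exp (2 * \<i> * w) = exp (\<i> * w) * exp (\<i> * w)"
    by (simp add: mult.assoc flip: exp_add)
  ultimately have "exp (2 * \<i> * w) * (cos w - \<i> * sin w) = cos w + \<i> * sin w"
    by (metis exp_Euler mult.assoc mult.right_neutral)
  then show ?thesis
    using assms by (simp add: tan_def field_simps)
qed

text \<open>
  Only the values \<open>\<plusminus>\<i>\<close> of \<open>tan\<close> correspond to the omitted values \<open>0\<close> and \<open>\<infinity>\<close> of \<open>exp\<close>. For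
  every other limit \<open>exp (2 \<i> z\<^sup>2)\<close> has a finite nonzero limit along the curve, so \<open>2 \<i> z\<^sup>2\<close>
  converges there, although the curve tends to infinity.
\<close>

lemma asymptotic_value_tan_sq:
  assumes "asymptotic_value (tan_sq l) a"
  shows "a = l + \<i> \<or> a = l - \<i>"
proof (rule ccontr)
  assume neq: "\<not> ?thesis"
  obtain g :: "real \<Rightarrow> complex" where cont: "continuous_on {0..} g"
    and pole: "\<And>t. t \<ge> 0 \<Longrightarrow> cos ((g t)\<^sup>2) \<noteq> 0"
    and inf: "filterlim g at_infinity at_top"
    and lim: "((\<lambda>t. tan_sq l (g t)) \<longlongrightarrow> a) at_top"
    using assms by (auto simp: asymptotic_value_def is_pole_tan_sq_iff)
  have tan_lim: "((\<lambda>t. tan ((g t)\<^sup>2)) \<longlongrightarrow> a - l) at_top"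
    using tendsto_diff[OF lim tendsto_const[of l]] by (simp add: tan_sq_def)
  have den: "1 - \<i> * (a - l) \<noteq> 0" and num: "1 + \<i> * (a - l) \<noteq> 0"
    using neq by (auto simp: complex_eq_iff)
  have "((\<lambda>t. (1 + \<i> * tan ((g t)\<^sup>2)) / (1 - \<i> * tan ((g t)\<^sup>2)))
      \<longlongrightarrow> (1 + \<i> * (a - l)) / (1 - \<i> * (a - l))) at_top"
    using den by (intro tendsto_intros tan_lim) auto
  moreover have "\<forall>\<^sub>F t in at_top. 1 - \<i> * tan ((g t)\<^sup>2) \<noteq> 0"
    by (rule tendsto_imp_eventually_ne[OF _ den]) (intro tendsto_intros tan_lim)
  then have "\<forall>\<^sub>F t in at_top.
      (1 + \<i> * tan ((g t)\<^sup>2)) / (1 - \<i> * tan ((g t)\<^sup>2)) = exp (2 * \<i> * (g t)\<^sup>2)"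
    using eventually_ge_at_top[of 0]
    by eventually_elim (simp add: exp_eq_tan[OF pole, symmetric])
  ultimately have "((\<lambda>t. exp (2 * \<i> * (g t)\<^sup>2))
      \<longlongrightarrow> (1 + \<i> * (a - l)) / (1 - \<i> * (a - l))) at_top"
    by (rule Lim_transform_eventually)
  moreover have "continuous_on {0..} (\<lambda>t. 2 * \<i> * (g t)\<^sup>2)"
    by (intro continuous_intros cont)
  ultimately obtain c where c: "((\<lambda>t. 2 * \<i> * (g t)\<^sup>2) \<longlongrightarrow> c) at_top"
    using exp_path_lift_converges den num by (metis divide_eq_0_iff)
  have "filterlim (\<lambda>t. 2 * \<i> * (g t)\<^sup>2) at_infinity at_top"
    by (intro tendsto_mult_filterlim_at_infinity[OF tendsto_const]
        Limits.filterlim_power_at_infinity[OF inf]) auto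
  then show False
    using c not_tendsto_and_filterlim_at_infinity[OF _ c] by auto
qed

lemma singular_values_tan_sq: "singular_values (tan_sq l) \<subseteq> {l, l + \<i>, l - \<i>}"
  using critical_point_tan_sq asymptotic_value_tan_sq
  by (fastforce simp: singular_values_def tan_sq_def)

section \<open>The contracting disc\<close>

lemma abs_Im_le_norm_cos: "\<bar>Im w\<bar> \<le> norm (cos w)"
proof -
  have "(Im w)\<^sup>2 \<le> ((exp (Im w) - inverse (exp (Im w))) / 2)\<^sup>2"
    using real_le_abs_sinh[of "Im w"] by (simp only: abs_le_square_iff)
  also have "\<dots> \<le> (norm (cos w))\<^sup>2"
    by (simp add: norm_cos_squared power_divide)
  finally have "\<bar>Im w\<bar> \<le> \<bar>norm (cos w)\<bar>"
    by (simp only: abs_le_square_iff)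
  then show ?thesis by simp
qed

lemma norm_tan_le_2:
  fixes w :: complex
  assumes "1 \<le> \<bar>Im w\<bar>"
  shows "norm (tan w) \<le> 2"
proof -
  have c: "1 \<le> norm (cos w)"
    using assms abs_Im_le_norm_cos[of w] by linarith
  have "(norm (sin w))\<^sup>2 = norm (1 - (cos w)\<^sup>2)"
    by (metis norm_power sin_squared_eq)
  also have "\<dots> \<le> 1 + (norm (cos w))\<^sup>2"
    using norm_triangle_ineq4[of 1 "(cos w)\<^sup>2"] by (simp add: norm_power)
  also have "\<dots> \<le> (2 * norm (cos w))\<^sup>2"
    using one_le_power[OF c, of 2] by (simp add: power_mult_distrib)
  finally have "norm (sin w) \<le> 2 * norm (cos w)"
    by (rule power2_le_imp_le) auto
  then show ?thesis
    using c by (simp add: tan_def norm_divide divide_le_eq)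
qed

text \<open>
  Since \<open>Im (z\<^sup>2) = 2 Re z Im z\<close>, both bounds come from comparing the product of the coordinates with
  their sum. The second one lets the square of \<open>cos (z\<^sup>2)\<close> absorb the growing factor \<open>2 z\<close> in the
  derivative.
\<close>

lemma Im_power2_bound:
  assumes "2 \<le> \<bar>Re z\<bar>" "2 \<le> \<bar>Im z\<bar>"
  shows "4 \<le> \<bar>Im (z\<^sup>2)\<bar>" "norm z \<le> \<bar>Im (z\<^sup>2)\<bar>"
proof -
  have eq: "\<bar>Im (z\<^sup>2)\<bar> = 2 * (\<bar>Re z\<bar> * \<bar>Im z\<bar>)"
    by (simp add: power2_eq_square abs_mult)
  have "2 * \<bar>Im z\<bar> \<le> \<bar>Re z\<bar> * \<bar>Im z\<bar>" "\<bar>Re z\<bar> * 2 \<le> \<bar>Re z\<bar> * \<bar>Im z\<bar>"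
    using assms by (auto intro!: mult_mono)
  then show "4 \<le> \<bar>Im (z\<^sup>2)\<bar>" "norm z \<le> \<bar>Im (z\<^sup>2)\<bar>"
    using assms cmod_le[of z] unfolding eq by linarith+
qed

lemma norm_deriv_tan_sq_le:
  assumes "2 \<le> \<bar>Re z\<bar>" "2 \<le> \<bar>Im z\<bar>"
  shows "norm (2 * z / (cos (z\<^sup>2))\<^sup>2) \<le> 1/2"
proof -
  define c where "c = norm (cos (z\<^sup>2))"
  have c: "4 \<le> c" "norm z \<le> c"
    using Im_power2_bound[OF assms] abs_Im_le_norm_cos[of "z\<^sup>2"] by (auto simp: c_def)
  have "4 * norm z \<le> c * c"
    using c by (intro mult_mono) auto
  moreover have "norm (2 * z / (cos (z\<^sup>2))\<^sup>2) = 2 * norm z / (c * c)"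
    by (simp add: norm_divide norm_mult norm_power c_def power2_eq_square)
  ultimately show ?thesis
    using c by (simp add: divide_le_eq)
qed

locale far_from_axes =
  fixes l :: complex
  assumes Re_gt: "4 < \<bar>Re l\<bar>" and Im_gt: "4 < \<bar>Im l\<bar>"
begin

lemma cball_far_from_axes:
  assumes "z \<in> cball l 2"
  shows "2 \<le> \<bar>Re z\<bar>" "2 \<le> \<bar>Im z\<bar>"
  using assms Re_gt Im_gt abs_Re_le_cmod[of "l - z"] abs_Im_le_cmod[of "l - z"]
  by (auto simp: dist_norm)

lemma cos_nonzero_cball: "z \<in> cball l 2 \<Longrightarrow> cos (z\<^sup>2) \<noteq> 0"
  using Im_power2_bound(1)[OF cball_far_from_axes] abs_Im_le_norm_cos[of "z\<^sup>2"] by fastforce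

lemma tan_sq_maps_cball:
  assumes "z \<in> cball l 2"
  shows "tan_sq l z \<in> cball l 2"
  using norm_tan_le_2[of "z\<^sup>2"] Im_power2_bound(1)[OF cball_far_from_axes[OF assms]]
  by (simp add: tan_sq_def dist_norm)

lemma tan_sq_contracts_cball:
  assumes "x \<in> cball l 2" "y \<in> cball l 2"
  shows "dist (tan_sq l x) (tan_sq l y) \<le> 1/2 * dist x y"
  unfolding dist_norm
  using assms has_field_derivative_tan_sq cos_nonzero_cball norm_deriv_tan_sq_le
    cball_far_from_axes
  by (intro field_differentiable_bound[where S = "cball l 2"]) auto

lemma attracting_fixed_point_cball:
  obtains p where "attracting_fixed_point (tan_sq l) p"
    "\<And>z. z \<in> cball l 2 \<Longrightarrow> attracted_by (tan_sq l) z p"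
proof -
  have "\<exists>!p. p \<in> cball l 2 \<and> tan_sq l p = p"
    by (rule Banach_fix[where c = "1/2"])
      (use tan_sq_maps_cball tan_sq_contracts_cball in \<open>auto simp: complete_eq_closed\<close>)
  then obtain p where p: "p \<in> cball l 2" "tan_sq l p = p"
    by blast
  have "attracting_fixed_point (tan_sq l) p"
    using p cos_nonzero_cball norm_deriv_tan_sq_le cball_far_from_axes
      DERIV_imp_deriv[OF has_field_derivative_tan_sq, of p l]
    by (fastforce simp: attracting_fixed_point_def is_pole_tan_sq_iff)
  moreover have "attracted_by (tan_sq l) z p" if z: "z \<in> cball l 2" for z
  proof -
    have stay: "(tan_sq l ^^ n) z \<in> cball l 2" for n
      by (induction n) (use z tan_sq_maps_cball in auto)
    have bound: "dist ((tan_sq l ^^ n) z) p \<le> (1/2) ^ n * dist z p" for n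
    proof (induction n)
      case (Suc n)
      then show ?case
        using tan_sq_contracts_cball[OF stay[of n] p(1)] p(2) by simp
    qed simp
    have "(\<lambda>n. (1/2) ^ n * dist z p) \<longlonglongrightarrow> 0"
      by (intro tendsto_mult_left_zero LIMSEQ_realpow_zero) auto
    then have "(\<lambda>n. dist ((tan_sq l ^^ n) z) p) \<longlonglongrightarrow> 0"
      by (rule Lim_null_comparison[rotated]) (use bound in simp)
    then have "(\<lambda>n. (tan_sq l ^^ n) z) \<longlonglongrightarrow> p"
      using tendsto_dist_iff by blast
    then show ?thesis
      using stay cos_nonzero_cball by (auto simp: attracted_by_def is_pole_tan_sq_iff)
  qed
  ultimately show thesis using that by blast
qed

lemma singular_values_attracted:
  "\<exists>p. attracting_fixed_point (tan_sq l) p \<and>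
     (\<forall>v \<in> singular_values (tan_sq l). attracted_by (tan_sq l) v p)"
proof -
  have "singular_values (tan_sq l) \<subseteq> cball l 2"
    using singular_values_tan_sq[of l] by (auto simp: dist_norm)
  then show ?thesis
    using attracting_fixed_point_cball by (metis subsetD)
qed

end

section \<open>The four quadrants\<close>

definition quadrant :: "real \<Rightarrow> real \<Rightarrow> complex set" where
  "quadrant s t = {z. 4 < s * Re z \<and> 4 < t * Im z}"

lemma region_quadrant:
  assumes "\<bar>s\<bar> = 1" "\<bar>t\<bar> = 1"
  shows "region (quadrant s t)" "\<not> bounded (quadrant s t)"
proof -
  have mem: "Complex (s * r) (t * r) \<in> quadrant s t" if "r > 4" for r
    using that assms by (auto simp: quadrant_def abs_if split: if_splits)
  have "open (quadrant s t)"
    unfolding quadrant_def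
    by (intro open_Collect_conj open_Collect_less continuous_intros)
  moreover have "convex (quadrant s t)"
  proof -
    have "quadrant s t = {z. inner (of_real s) z > 4} \<inter> {z. inner (t *\<^sub>R \<i>) z > 4}"
      by (auto simp: quadrant_def inner_complex_def)
    then show ?thesis
      by (simp only: convex_Int convex_halfspace_gt)
  qed
  ultimately show "region (quadrant s t)"
    using mem[of 5] convex_connected by (auto simp: region_def)
  show "\<not> bounded (quadrant s t)"
  proof
    assume "bounded (quadrant s t)"
    then obtain B where B: "\<And>z. z \<in> quadrant s t \<Longrightarrow> norm z \<le> B"
      by (auto simp: bounded_iff)
    define r where "r = \<bar>B\<bar> + 5"
    have "r \<le> norm (Complex (s * r) (t * r))"
      using abs_Re_le_cmod[of "Complex (s * r) (t * r)"] assms by (simp add: abs_mult r_def)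
    moreover have "norm (Complex (s * r) (t * r)) \<le> B"
      by (rule B, rule mem) (simp add: r_def)
    ultimately show False
      by (simp add: r_def)
  qed
qed

lemma far_from_axes_quadrant:
  assumes "\<bar>s\<bar> = 1" "\<bar>t\<bar> = 1" "l \<in> quadrant s t"
  shows "far_from_axes l"
  using assms by unfold_locales (auto simp: quadrant_def abs_if split: if_splits)

theorem lemma4p3:
  shows "\<exists>A\<^sub>1 A\<^sub>2 A\<^sub>3 A\<^sub>4 :: complex set.
           A\<^sub>1 \<subseteq> {z. Re z > 0 \<and> Im z > 0} \<and>
           A\<^sub>2 \<subseteq> {z. Re z < 0 \<and> Im z > 0} \<and>
           A\<^sub>3 \<subseteq> {z. Re z < 0 \<and> Im z < 0} \<and>
           A\<^sub>4 \<subseteq> {z. Re z > 0 \<and> Im z < 0} \<and>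
           (\<forall>A \<in> {A\<^sub>1, A\<^sub>2, A\<^sub>3, A\<^sub>4}.
              region A \<and> \<not> bounded A \<and>
              (\<forall>l \<in> A. \<exists>p. attracting_fixed_point (tan_sq l) p \<and>
                 (\<forall>v \<in> singular_values (tan_sq l). attracted_by (tan_sq l) v p)))"
proof -
  have good: "region (quadrant s t) \<and> \<not> bounded (quadrant s t) \<and>
      (\<forall>l \<in> quadrant s t. \<exists>p. attracting_fixed_point (tan_sq l) p \<and>
        (\<forall>v \<in> singular_values (tan_sq l). attracted_by (tan_sq l) v p))"
    if "\<bar>s\<bar> = 1" "\<bar>t\<bar> = 1" for s t
    using region_quadrant[OF that] far_from_axes_quadrant[OF that]
      far_from_axes.singular_values_attracted by blast
  have "quadrant 1 1 \<subseteq> {z. Re z > 0 \<and> Im z > 0}"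
    "quadrant (-1) 1 \<subseteq> {z. Re z < 0 \<and> Im z > 0}"
    "quadrant (-1) (-1) \<subseteq> {z. Re z < 0 \<and> Im z < 0}"
    "quadrant 1 (-1) \<subseteq> {z. Re z > 0 \<and> Im z < 0}"
    by (auto simp: quadrant_def)
  with good[of 1 1] good[of "-1" 1] good[of "-1" "-1"] good[of 1 "-1"] show ?thesis
    by (intro exI[of _ "quadrant 1 1"] exI[of _ "quadrant (-1) 1"]
        exI[of _ "quadrant (-1) (-1)"] exI[of _ "quadrant 1 (-1)"]) simp
qed

end
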